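(* Let $h$ and $k$ be positive integers with $3 \leq h \leq k-1$, and let $A = \{a_1, \ldots, a_k\}$ be a set of positive integers with $a_1 < \cdots < a_k$. Then \[|h^{\wedge}_{\pm}A| \geq 2hk - h^2 + 1.\] This lower bound is best possible: for all such $h$ and $k$ there is a set $A$ of $k$ positive integers with $|h^{\wedge}_{\pm}A| = 2hk - h^2 + 1$.
   Context: For a finite set $A = \{a_1, \ldots, a_k\}$ of integers (with distinct $a_i$) and a positive integer $h$, the restricted $h$-fold signed sumset is \[h^{\wedge}_{\pm}A = \left\{ \sum_{i=1}^{k} \lambda_i a_i : \lambda_i \in \{-1,0,1\} \text{ for } i=1,\ldots,k, \ \sum_{i=1}^{k} |\lambda_i| = h \right\}.\] *)

theory Defs
  imports Complex_Main
begin

text \<open>The restricted \<open>h\<close>-fold signed sumset of a finite set of integers. The elements of \<open>A\<close>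
  serve as their own indices, so the coefficient of \<open>a \<in> A\<close> is \<open>c a\<close>; values of \<open>c\<close> outside
  \<open>A\<close> are irrelevant.\<close>

definition restricted_signed_sumset :: "nat \<Rightarrow> int set \<Rightarrow> int set" where
  "restricted_signed_sumset h A =
     {\<Sum>a\<in>A. c a * a | c :: int \<Rightarrow> int.
        (\<forall>a\<in>A. c a \<in> {-1, 0, 1}) \<and> (\<Sum>a\<in>A. \<bar>c a\<bar>) = int h}"

end

theory Submission
  imports Defs
begin

text \<open>Deleting the largest element of \<open>A\<close> removes at least \<open>2h\<close> signed sums, because in the largest
  \<open>h\<close>-fold sum of the other elements each summand can be exchanged for the maximum. This reduces
  the bound to \<open>|A| = h + 1\<close>. After a translation the signed sums are then the numbers
  \<open>a + 2 \<Sum>J\<close> with \<open>a \<in> A\<close> and \<open>J \<subseteq> A - {a}\<close>, of which there should be \<open>|A|\<^sup>2\<close>. Deleting the largest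
  element \<open>M\<close> again, it suffices to find \<open>2 |A| - 1\<close> such numbers below \<open>x + 2M\<close>, where \<open>x = min A\<close>.
  The elements of \<open>A\<close> themselves account for \<open>|A|\<close> of them. The others are sought in the window
  between \<open>M\<close> and \<open>x + 2M\<close> among the sums \<open>a + 2b\<close>: if no two elements \<open>p, q < M\<close> differ by
  \<open>(M - x) / 2\<close>, the sums \<open>M + 2b\<close> and \<open>x + 2b\<close> suffice, and otherwise the sums \<open>a + 2p\<close> and
  \<open>a + 2q\<close> represent \<open>|A| - 1\<close> residues modulo \<open>M - x\<close>, at most one of which is spoiled by the
  condition \<open>a \<noteq> b\<close>. A missing sum can be recovered unless \<open>A\<close> consists of \<open>x\<close> and an arithmetic
  progression of odd multiples of \<open>x\<close>, a case that is counted directly. The only exception is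
  \<open>{x, 3x, 5x}\<close>, which is why \<open>h = 2\<close> is excluded.\<close>

section \<open>Sums \<open>a + 2 * b\<close> in a window above the maximum\<close>

locale pos_int_set =
  fixes P :: "int set" and x M :: int
  assumes fin: "finite P" and x_in: "x \<in> P" and M_in: "M \<in> P"
    and bounds: "\<And>a. a \<in> P \<Longrightarrow> x \<le> a \<and> a \<le> M"
    and x_pos: "0 < x" and x_less_M: "x < M"
begin

text \<open>Values above \<open>M\<close> cannot meet \<open>P\<close>. The upper end serves the
  later reflection: if \<open>u < x + 2 * M\<close>, then \<open>2 * \<Sum>P - u\<close> exceeds
  \<open>2 * \<Sum>(P - {M}) - x\<close>, an upper bound for all sums that avoid
  \<open>M\<close>.\<close>

definition window :: "int set" where
  "window = {a + 2 * b | a b. a \<in> P \<and> b \<in> P \<and> a \<noteq> b \<and> M < a + 2 * b \<and> a + 2 * b < x + 2 * M}"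

lemma windowI:
  "a \<in> P \<Longrightarrow> b \<in> P \<Longrightarrow> a \<noteq> b \<Longrightarrow> M < a + 2 * b \<Longrightarrow> a + 2 * b < x + 2 * M \<Longrightarrow> a + 2 * b \<in> window"
  unfolding window_def by blast

lemma finite_window: "finite window"
  by (rule finite_subset[of _ "{M..x + 2 * M}"]) (auto simp: window_def)

lemma card_minus_M: "card (P - {M}) = card P - 1"
  using fin M_in by simp

lemma window_card_no_pair:
  assumes "\<And>p q. p \<in> P \<Longrightarrow> q \<in> P \<Longrightarrow> q < M \<Longrightarrow> 2 * q - 2 * p \<noteq> M - x"
  shows "card P - 1 \<le> card window"
proof -
  \<comment> \<open>Pairing small \<open>a\<close> with \<open>M\<close> and large \<open>a\<close>
    with \<open>x\<close> keeps both branches inside the window. They can collide only through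
    \<open>M + 2 * a = x + 2 * b\<close>, that is \<open>2 * b - 2 * a = M - x\<close>, which the
    hypothesis forbids.\<close>
  define g where "g a = (if 2 * a < M + x then M + 2 * a else x + 2 * a)" for a
  have "inj_on g (P - {M})"
  proof (rule inj_onI)
    fix a b assume a: "a \<in> P - {M}" and b: "b \<in> P - {M}" and e: "g a = g b"
    have "a < M" "b < M" using a b bounds by force+
    then show "a = b" using e assms[of a b] assms[of b a] a b
      by (auto simp: g_def split: if_splits)
  qed
  moreover have "g ` (P - {M}) \<subseteq> window"
  proof
    fix u assume "u \<in> g ` (P - {M})"
    then obtain a where a: "a \<in> P" "a \<noteq> M" and u: "u = g a" by blast
    have "x \<le> a" "a < M" using a bounds by force+
    then show "u \<in> window"
      using a x_pos x_less_M x_in M_in u windowI[of M a] windowI[of x a] by (auto simp: g_def)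
  qed
  ultimately show ?thesis
    using card_mono[OF finite_window] card_image card_minus_M by metis
qed

end

text \<open>If \<open>q = p + (M - x) / 2\<close>, then of the two numbers \<open>a + 2p\<close> and \<open>a + 2q\<close>, which are congruent
  modulo \<open>M - x\<close>, one falls into the window; distinct \<open>a < M\<close> give distinct residues.\<close>

locale pos_int_set_pair = pos_int_set +
  fixes p q :: int
  assumes p_in: "p \<in> P" and q_in: "q \<in> P" and q_less: "q < M"
    and pq: "2 * q - 2 * p = M - x"
begin

definition f :: "int \<Rightarrow> int" where
  "f a = (if a + 2 * p > M then a + 2 * p else a + 2 * q)"

lemma p_less_q: "p < q"
  using pq x_less_M by linarith

lemma x_le_p: "x \<le> p" using bounds p_in by blast

lemma f_bounds:
  assumes "a \<in> P" "a \<noteq> M"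
  shows "M < f a" "f a < x + 2 * M"
proof -
  have "x \<le> a" "a < M" using assms bounds by force+
  then show "M < f a" "f a < x + 2 * M"
    using x_le_p pq q_less x_pos x_less_M by (auto simp: f_def)
qed

text \<open>All elements other than \<open>M\<close> lie in the half-open interval from
  \<open>x\<close> to \<open>M\<close>, whose length is the modulus \<open>M - x\<close>.\<close>

lemma f_cong_imp_eq:
  assumes "a \<in> P" "a \<noteq> M" "b \<in> P" "b \<noteq> M"
    and "f a = b + 2 * p \<or> f a = b + 2 * q"
  shows "a = b"
proof -
  have "x \<le> a" "a < M" "x \<le> b" "b < M" using assms bounds by force+
  then show ?thesis using assms(5) pq by (auto simp: f_def split: if_splits)
qed

lemma inj_f: "inj_on f (P - {M})"
proof (rule inj_onI)
  fix a b assume "a \<in> P - {M}" "b \<in> P - {M}" "f a = f b"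
  moreover have "f b = b + 2 * p \<or> f b = b + 2 * q" by (simp add: f_def)
  ultimately show "a = b" using f_cong_imp_eq[of a b] by auto
qed

text \<open>The value \<open>f a\<close> is not an admissible sum if it is \<open>3p\<close> or \<open>3q\<close>. The two do not occur together:
  if \<open>f p = 3p\<close>, then \<open>q + 2p > M\<close> and \<open>f q = q + 2p\<close>.\<close>

definition bad :: int where
  "bad = (if M < 3 * p then 3 * p else 3 * q)"

lemma f_in_window:
  assumes "a \<in> P" "a \<noteq> M" "f a \<noteq> bad"
  shows "f a \<in> window"
proof -
  have "a \<noteq> p" if "a + 2 * p > M" using that assms(3) by (auto simp: f_def bad_def)
  moreover have "a \<noteq> q" if "\<not> a + 2 * p > M"
    using that assms(3) p_less_q by (auto simp: f_def bad_def)
  ultimately show ?thesis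
    using f_bounds[OF assms(1,2)] assms(1) p_in q_in windowI[of a p] windowI[of a q]
    by (auto simp: f_def split: if_splits)
qed

lemma good_subset: "f ` (P - {M}) - {bad} \<subseteq> window"
  using f_in_window by auto

lemma card_f_image: "card (f ` (P - {M})) = card P - 1"
  using card_image[OF inj_f] card_minus_M by simp

lemma window_card_pair: "card P - 2 \<le> card window"
proof -
  have "card (f ` (P - {M})) - 1 \<le> card (f ` (P - {M}) - {bad})"
    by (simp add: card_Diff_singleton_if)
  also have "\<dots> \<le> card window" using card_mono[OF finite_window good_subset] .
  finally show ?thesis using card_f_image by simp
qed

text \<open>The image of \<open>f\<close> loses at most the value \<open>bad\<close>. Any further
  window element compensates, including \<open>bad\<close> itself when another pair of distinct
  elements represents it.\<close>

lemma window_card_extra: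
  assumes "w \<in> window" "w = bad \<or> w \<notin> f ` (P - {M})"
  shows "card P - 1 \<le> card window"
proof -
  have fin: "finite (f ` (P - {M}))" using local.fin by simp
  have "card P - 1 \<le> card (insert w (f ` (P - {M}) - {bad}))"
    using assms(2) fin card_f_image
    by (cases "w = bad") (auto simp: card_insert_if card_Diff_singleton_if insert_absorb)
  also have "\<dots> \<le> card window"
    using card_mono[OF finite_window] good_subset assms(1) by simp
  finally show ?thesis .
qed

text \<open>If \<open>a + 2 * p\<close> lies below \<open>M + 2 * x\<close>, then
  \<open>a + 2 * q\<close>, larger by \<open>M - x\<close>, still lies below
  \<open>x + 2 * M\<close>. So one residue has two representatives in the window, and the second
  compensates for the lost value, provided \<open>a \<noteq> q\<close>.\<close>

lemma window_card_double:
  assumes v: "v \<in> window" "v < M + 2 * x"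
  shows "card P - 1 \<le> card window"
proof (cases "v \<in> f ` (P - {M})")
  case False
  then show ?thesis using window_card_extra v by blast
next
  case True
  then obtain a where a: "a \<in> P" "a \<noteq> M" and va: "v = f a" by blast
  have ax: "x \<le> a" "a < M" using a bounds by force+
  have fa: "f a = a + 2 * p" using va v(2) x_le_p pq ax by (auto simp: f_def split: if_splits)
  show ?thesis
  proof (cases "M < 3 * p \<and> 3 * p < M + 2 * x")
    case True
    \<comment> \<open>Here the residue of \<open>3 * p\<close> is the doubled one. Its second
      representative \<open>p + 2 * q\<close> is admissible although \<open>3 * p\<close> is of the
      form \<open>a + 2 * a\<close>.\<close>
    have "p + 2 * q \<in> window"
      using windowI[OF p_in q_in] True p_less_q pq by auto
    moreover have "p + 2 * q \<notin> f ` (P - {M})"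
    proof
      assume "p + 2 * q \<in> f ` (P - {M})"
      then obtain b where b: "b \<in> P" "b \<noteq> M" "f b = p + 2 * q" by (metis DiffE imageE insertI1)
      then have "b = p" using f_cong_imp_eq[of b p] p_in p_less_q q_less by auto
      then show False using b True p_less_q by (simp add: f_def)
    qed
    ultimately show ?thesis using window_card_extra by blast
  next
    case np: False
    show ?thesis
    proof (cases "a = q")
      case True
      \<comment> \<open>Now \<open>bad\<close> is \<open>3 * q\<close>, but the residue of
        \<open>q\<close> is represented by \<open>q + 2 * p\<close>. Hence \<open>f\<close> never
        takes the value \<open>bad\<close>, and nothing is lost.\<close>
      have "\<not> M < 3 * p" using np va v(2) fa True p_less_q by linarith
      have "M < q + 2 * p" using fa True f_bounds[OF a] by simp
      have "bad \<notin> f ` (P - {M})"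
      proof
        assume "bad \<in> f ` (P - {M})"
        then have "q + 2 * q \<in> f ` (P - {M})" using \<open>\<not> M < 3 * p\<close> by (simp add: bad_def)
        then obtain b where b: "b \<in> P" "b \<noteq> M" "f b = q + 2 * q" by (metis DiffE imageE insertI1)
        then have "b = q" using f_cong_imp_eq[of b q] q_in q_less by auto
        then show False using b \<open>M < q + 2 * p\<close> p_less_q by (simp add: f_def)
      qed
      then have "f ` (P - {M}) - {bad} = f ` (P - {M})" by (rule Diff_insert0[THEN trans]) simp
      then have "f ` (P - {M}) \<subseteq> window" using good_subset by metis
      then show ?thesis using card_mono[OF finite_window] card_f_image by metis
    next
      case False
      have "a + 2 * q \<in> window"
        using windowI[OF a(1) q_in False] va fa v(2) pq f_bounds[OF a] p_less_q by auto
      moreover have "a + 2 * q \<notin> f ` (P - {M})"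
      proof
        assume "a + 2 * q \<in> f ` (P - {M})"
        then obtain b where b: "b \<in> P" "b \<noteq> M" "f b = a + 2 * q" by (metis DiffE imageE insertI1)
        then have "b = a" using f_cong_imp_eq[of b a] a by auto
        then show False using b fa p_less_q by simp
      qed
      ultimately show ?thesis using window_card_extra by blast
    qed
  qed
qed

text \<open>Steps of \<open>2 * x\<close> from any \<open>a \<noteq> x\<close> stay in
  \<open>P\<close> until they hit \<open>M\<close> exactly, since \<open>gap\<close> forbids jumping
  over \<open>M\<close>. So these \<open>a\<close> are congruent to \<open>M\<close> modulo
  \<open>2 * x\<close>, and they fill the progression from their minimum up to
  \<open>M\<close>.\<close>

lemma arith_progression_if_closed:
  assumes closed: "\<And>a. a \<in> P - {x} \<Longrightarrow> a + 2 * x < M \<Longrightarrow> a + 2 * x \<in> P"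
    and gap: "\<And>a. a \<in> P - {x} \<Longrightarrow> \<not> (M < a + 2 * x \<and> a + 2 * x < M + 2 * x)"
  obtains s m where "1 \<le> s" "2 * s \<le> m" "M = x * (2 * m + 1)"
    "P = (\<lambda>t. x * (2 * t + 1)) ` insert 0 {s..m}"
proof -
  have dvd: "2 * x dvd M - a" if "a \<in> P - {x}" for a
    using that
  proof (induction "nat (M - a)" arbitrary: a rule: less_induct)
    case less
    have a: "x < a" "a \<le> M" using less.prems bounds by force+
    show ?case
    proof (cases "a + 2 * x < M")
      case True
      then have "2 * x dvd M - (a + 2 * x)"
        using less.hyps[of "a + 2 * x"] closed[OF less.prems] a x_pos by auto
      then have "2 * x dvd M - (a + 2 * x) + 2 * x" by (intro dvd_add) auto
      then show ?thesis by (simp add: algebra_simps)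
    next
      case False
      then have "a = M \<or> M = a + 2 * x" using gap[OF less.prems] a by linarith
      then show ?thesis by auto
    qed
  qed
  have up: "a + 2 * x * int k \<in> P" if "a \<in> P - {x}" "a + 2 * x * int k \<le> M" for a k
    using that(2)
  proof (induction k)
    case 0
    then show ?case using that by simp
  next
    case (Suc k)
    have e: "a + 2 * x * int (Suc k) = a + 2 * x * int k + 2 * x" by (simp add: algebra_simps)
    have "a + 2 * x * int k \<in> P" using Suc e x_pos by auto
    moreover have "x < a + 2 * x * int k"
    proof -
      have "x < a" using that(1) bounds by force
      moreover have "0 \<le> 2 * x * int k" using x_pos by simp
      ultimately show ?thesis by linarith
    qed
    ultimately have "a + 2 * x * int k + 2 * x < M \<Longrightarrow> a + 2 * x * int k + 2 * x \<in> P"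
      using closed[of "a + 2 * x * int k"] by simp
    then show ?case unfolding e using Suc.prems[unfolded e] M_in by (metis order_le_less)
  qed
  have qx: "q \<in> P - {x}" using q_in p_less_q x_le_p by auto
  \<comment> \<open>Since \<open>M - x = 2 * (q - p)\<close>, this puts \<open>x\<close> into the
    residue class of \<open>M\<close> too, so every element is an odd multiple of
    \<open>x\<close>.\<close>
  have "2 * x dvd q - p"
  proof (cases "p = x")
    case True
    then have "q - p = M - q" using pq by linarith
    then show ?thesis using dvd[OF qx] by metis
  next
    case False
    then have "2 * x dvd (M - p) - (M - q)" using dvd_diff[OF dvd[of p] dvd[OF qx]] p_in by simp
    then show ?thesis by simp
  qed
  then have "2 * x dvd 2 * (q - p)" by (rule dvd_mult)
  then have dvdM: "2 * x dvd M - x" using pq by (simp add: right_diff_distrib)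
  have dvdx: "2 * x dvd a - x" if "a \<in> P" for a
  proof (cases "a = x")
    case False
    then have "2 * x dvd (M - x) - (M - a)" using dvd_diff[OF dvdM dvd[of a]] that by simp
    then show ?thesis by simp
  qed auto
  have form: "\<exists>t. a = x * (2 * t + 1)" if a: "a \<in> P" for a
  proof -
    obtain t where "a - x = 2 * x * t" using dvdx[OF a] by (auto elim: dvdE)
    then have "a = x * (2 * t + 1)" by (simp add: algebra_simps)
    then show ?thesis by blast
  qed
  define y where "y = Min (P - {x})"
  have ne: "P - {x} \<noteq> {}" "finite (P - {x})" using M_in x_less_M fin by auto
  have y: "y \<in> P - {x}" using Min_in[OF ne(2,1)] by (simp add: y_def)
  have y_le: "y \<le> a" if "a \<in> P - {x}" for a using Min_le[OF ne(2) that] by (simp add: y_def)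
  obtain s where s: "y = x * (2 * s + 1)" using form y by blast
  obtain m where m: "M = x * (2 * m + 1)" using form M_in by blast
  have "x < y" using y bounds by force
  then have "x * 1 < x * (2 * s + 1)" using s by simp
  then have s1: "1 \<le> s" using x_pos by (simp only: mult_less_cancel_left_pos)
  \<comment> \<open>The pair has a member other than \<open>x\<close> that is at most the midpoint
    of \<open>x\<close> and \<open>M\<close>: \<open>q\<close> if \<open>p = x\<close>, and
    \<open>p\<close> otherwise. This becomes \<open>2 * s \<le> m\<close>.\<close>
  have "2 * y \<le> M + x"
  proof (cases "p = x")
    case True
    then show ?thesis using y_le[OF qx] pq by linarith
  next
    case False
    then show ?thesis using y_le[of p] p_in pq q_less by force
  qed
  then have "x * (4 * s + 2) \<le> x * (2 * m + 2)" using s m by (simp add: algebra_simps)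
  then have sm: "2 * s \<le> m" using x_pos by (simp only: mult_le_cancel_left_pos)
  have "P = (\<lambda>t. x * (2 * t + 1)) ` insert 0 {s..m}" (is "_ = ?R")
  proof
    show "P \<subseteq> ?R"
    proof
      fix a assume a: "a \<in> P"
      obtain t where t: "a = x * (2 * t + 1)" using form a by blast
      show "a \<in> ?R"
      proof (cases "a = x")
        case False
        then have "y \<le> a" "a \<le> M" using y_le a bounds by auto
        then have "x * (2 * s + 1) \<le> x * (2 * t + 1)" "x * (2 * t + 1) \<le> x * (2 * m + 1)"
          using s t m by auto
        then have "s \<le> t" "t \<le> m" using x_pos by (simp_all only: mult_le_cancel_left_pos)
        then show ?thesis using t by auto
      qed auto
    qed
    show "?R \<subseteq> P"
    proof
      fix a assume "a \<in> ?R"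
      then consider "a = x" | t where "a = x * (2 * t + 1)" "s \<le> t" "t \<le> m" by fastforce
      then show "a \<in> P"
      proof cases
        case 2
        have "a = y + 2 * x * int (nat (t - s))" using 2 s by (simp add: algebra_simps)
        moreover have "a \<le> M" using 2 m x_pos by simp
        ultimately show ?thesis using up[OF y] by metis
      qed (use x_in in simp)
    qed
  qed
  then show thesis using that s1 sm m by blast
qed

end

section \<open>Counting in the arithmetic progression\<close>

text \<open>In the coordinate \<open>t\<close> of \<open>x * (2 * t + 1)\<close>, the sum
  \<open>a + 2 * b\<close> becomes \<open>a + 2 * b + 1\<close>, and the window becomes the range
  above \<open>m\<close> up to \<open>2 * m\<close>. The target \<open>m - s + 1\<close> is one less
  than the number of elements of the progression.\<close>

lemma arith_progression_window_card:
  fixes s m :: int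
  assumes s: "1 \<le> s" and sm: "2 * s \<le> m" "s + 2 \<le> m"
  defines "I \<equiv> insert 0 {s..m}"
  shows "nat (m - s + 1) \<le>
    card {a + 2 * b + 1 | a b. a \<in> I \<and> b \<in> I \<and> a \<noteq> b \<and> m < a + 2 * b + 1 \<and> a + 2 * b + 1 \<le> 2 * m}"
    (is "_ \<le> card ?S")
proof -
  have fin: "finite ?S" by (rule finite_subset[of _ "{m..2 * m}"]) auto
  have inS: "a + 2 * b + 1 \<in> ?S" if "a \<in> I" "b \<in> I" "a \<noteq> b" "m < a + 2 * b + 1" "a + 2 * b + 1 \<le> 2 * m"
    for a b using that by blast
  have bot: "m + 1 \<in> ?S" using inS[of m 0] s sm by (auto simp: I_def)
  have zero: "2 * b + 1 \<in> ?S" if "b \<in> {s..m}" "m < 2 * b + 1" "2 * b + 1 \<le> 2 * m" for b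
    using inS[of 0 b] that s by (auto simp: I_def)
  show ?thesis
  proof (cases "m = s + 2")
    case True
    \<comment> \<open>\<open>2 * s \<le> s + 2\<close> leaves only \<open>s \<le> 2\<close>.\<close>
    then consider "s = 1" "m = 3" | "s = 2" "m = 4" using s sm by linarith
    then show ?thesis
    proof cases
      case 1
      have "4 \<in> ?S" "5 \<in> ?S" "6 \<in> ?S"
        using inS[of 3 0] inS[of 0 2] inS[of 1 2] 1 by (simp_all add: I_def)
      then have "card {4, 5, 6 :: int} \<le> card ?S" by (intro card_mono[OF fin] insert_subsetI empty_subsetI)
      then show ?thesis using 1 by simp
    next
      case 2
      have "5 \<in> ?S" "7 \<in> ?S" "8 \<in> ?S"
        using inS[of 4 0] inS[of 0 3] inS[of 3 2] 2 by (simp_all add: I_def)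
      then have "card {5, 7, 8 :: int} \<le> card ?S" by (intro card_mono[OF fin] insert_subsetI empty_subsetI)
      then show ?thesis using 2 by simp
    qed
  next
    case False
    then have m3: "s + 3 \<le> m" using sm by linarith
    \<comment> \<open>From \<open>3 * s + 2\<close> on, every value in the range occurs: with
      \<open>b = s\<close> as long as the matching \<open>a\<close> is at most \<open>m\<close>, and
      after that with \<open>a\<close> close to \<open>m\<close>.\<close>
    have mid: "w \<in> ?S" if w: "3 * s + 2 \<le> w" "m < w" "w \<le> 2 * m" for w
    proof (cases "w \<le> m + 2 * s + 1")
      case True
      then show ?thesis using inS[of "w - 2 * s - 1" s] w s sm by (auto simp: I_def)
    next
      case F: False
      \<comment> \<open>With this choice \<open>?a\<close> is \<open>m - 1\<close> or
        \<open>m\<close>, depending on the parity of \<open>w - m\<close>.\<close>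
      define b where "b = (w - m) div 2"
      have b: "w - m = 2 * b \<or> w - m = 2 * b + 1" unfolding b_def by presburger
      let ?a = "w - 2 * b - 1"
      show ?thesis
      proof (cases "w - m = 2 * b")
        case True
        show ?thesis
        proof (cases "?a = b")
          case False
          then show ?thesis using inS[of ?a b] True w F s sm m3 by (auto simp: I_def)
        next
          case True
          then show ?thesis using inS[of "w - 2 * (b + 1) - 1" "b + 1"] \<open>w - m = 2 * b\<close> w F s sm m3
            by (auto simp: I_def)
        qed
      next
        case nt: False
        then have wb: "w - m = 2 * b + 1" using b by blast
        show ?thesis
        proof (cases "?a = b")
          case False
          then show ?thesis using inS[of ?a b] wb w F s sm m3 by (auto simp: I_def)
        next
          case True
          then show ?thesis using inS[of "w - 2 * (b + 1) - 1" "b + 1"] wb w F s sm m3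
            by (auto simp: I_def)
        qed
      qed
    qed
    \<comment> \<open>The interval from \<open>3 * s + 2\<close> to \<open>2 * m\<close> has
      \<open>2 * m - 3 * s - 1\<close> elements, which suffices for \<open>m \<ge> 2 * s + 2\<close>
      if it lies above \<open>m\<close>. For \<open>m = 2 * s + 1\<close> one value is missing, for
      \<open>m = 2 * s\<close> two; \<open>m + 1\<close> and \<open>2 * s + 3\<close> supply
      them.\<close>
    consider "2 * s + 2 \<le> m" "3 * s + 2 \<le> m + 1" | "2 * s + 2 \<le> m" "m + 1 < 3 * s + 2"
      | "m = 2 * s + 1" | "m = 2 * s" using sm by linarith
    then show ?thesis
    proof cases
      case 1
      have "{m + 1..2 * m} \<subseteq> ?S" using mid 1 by force
      then have "card {m + 1..2 * m} \<le> card ?S" by (rule card_mono[OF fin])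
      then show ?thesis using s by simp
    next
      case 2
      have "{3 * s + 2..2 * m} \<subseteq> ?S" using mid 2 by force
      then have "card {3 * s + 2..2 * m} \<le> card ?S" by (rule card_mono[OF fin])
      then show ?thesis using s 2 by simp
    next
      case 3
      have "insert (m + 1) {3 * s + 2..2 * m} \<subseteq> ?S" using mid bot 3 s by force
      then have "card (insert (m + 1) {3 * s + 2..2 * m}) \<le> card ?S" by (rule card_mono[OF fin])
      then show ?thesis using s 3 by (simp add: card_insert_if)
    next
      case 4
      have "2 * (s + 1) + 1 \<in> ?S" using zero[of "s + 1"] 4 m3 s by simp
      then have "insert (m + 1) (insert (2 * (s + 1) + 1) {3 * s + 2..2 * m}) \<subseteq> ?S"
        using mid bot 4 s by force
      then have "card (insert (m + 1) (insert (2 * (s + 1) + 1) {3 * s + 2..2 * m})) \<le> card ?S"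
        by (rule card_mono[OF fin])
      then show ?thesis using s 4 m3 by (simp add: card_insert_if)
    qed
  qed
qed

section \<open>Low sums: the elements of \<open>P\<close> together with the window\<close>

context pos_int_set
begin

definition low_sums :: "int set" where
  "low_sums = {u. (u \<in> P \<or> (\<exists>a\<in>P. \<exists>b\<in>P. a \<noteq> b \<and> u = a + 2 * b)) \<and> u < x + 2 * M}"

lemma finite_low_sums: "finite low_sums"
proof (rule finite_subset)
  have pos: "0 < a" if "a \<in> P" for a using bounds[OF that] x_pos by linarith
  have "0 < a + 2 * b" if "a \<in> P" "b \<in> P" for a b using pos[OF that(1)] pos[OF that(2)] by linarith
  then show "low_sums \<subseteq> {0<..<x + 2 * M}" using pos by (auto simp: low_sums_def)
qed simp

lemma low_sums_superset: "P \<union> window \<subseteq> low_sums"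
proof -
  have "a < x + 2 * M" if "a \<in> P" for a using bounds[OF that] x_pos x_less_M by linarith
  then show ?thesis by (auto simp: low_sums_def window_def)
qed

lemma card_P_Un_window: "card (P \<union> window) = card P + card window"
proof (rule card_Un_disjoint)
  show "P \<inter> window = {}" using bounds by (force simp: window_def)
qed (use fin finite_window in auto)

theorem card_low_sums:
  assumes n: "3 \<le> card P" and exc: "P \<noteq> {x, 3 * x, 5 * x}"
  shows "2 * card P - 1 \<le> card low_sums"
proof -
  have win: ?thesis if "card P - 1 \<le> card window"
    using card_mono[OF finite_low_sums low_sums_superset] card_P_Un_window that by linarith
  show ?thesis
  proof (cases "\<exists>p\<in>P. \<exists>q\<in>P. q < M \<and> 2 * q - 2 * p = M - x")
    case False
    then show ?thesis using window_card_no_pair win by blast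
  next
    case True
    then obtain p q where "p \<in> P" "q \<in> P" "q < M" "2 * q - 2 * p = M - x" by blast
    then interpret pr: pos_int_set_pair P x M p q by unfold_locales
    show ?thesis
    proof (cases "\<exists>a\<in>P - {x}. a + 2 * x < M \<and> a + 2 * x \<notin> P")
      case True
      then obtain a where a: "a \<in> P - {x}" "a + 2 * x < M" "a + 2 * x \<notin> P" by blast
      \<comment> \<open>A low sum below \<open>M\<close> outside \<open>P\<close> is counted neither
        by \<open>P\<close> nor by the window, so it replaces the one value that the window may
        lack.\<close>
      have "a + 2 * x \<notin> window" using a(2) by (auto simp: window_def)
      moreover have "a + 2 * x \<in> low_sums" using a x_in x_pos x_less_M by (auto simp: low_sums_def)
      ultimately have "card (insert (a + 2 * x) (P \<union> window)) \<le> card low_sums"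
        using low_sums_superset by (intro card_mono[OF finite_low_sums]) auto
      moreover have "card (insert (a + 2 * x) (P \<union> window)) = card P + card window + 1"
        using card_P_Un_window fin finite_window a(3) \<open>a + 2 * x \<notin> window\<close> by simp
      ultimately show ?thesis using pr.window_card_pair n by linarith
    next
      case closed: False
      show ?thesis
      proof (cases "\<exists>a\<in>P - {x}. M < a + 2 * x \<and> a + 2 * x < M + 2 * x")
        case True
        then obtain a where a: "a \<in> P" "a \<noteq> x" "M < a + 2 * x" "a + 2 * x < M + 2 * x" by blast
        then have "a + 2 * x \<in> window" using windowI[of a x] x_in x_less_M by auto
        then show ?thesis using pr.window_card_double a(4) win by blast
      next
        case False
        then obtain s m where sm: "1 \<le> s" "2 * s \<le> m" and M: "M = x * (2 * m + 1)"
          and P: "P = (\<lambda>t. x * (2 * t + 1)) ` insert 0 {s..m}"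
          using pr.arith_progression_if_closed closed by blast
        let ?g = "\<lambda>t. x * (2 * t + 1)"
        have inj: "inj ?g" using x_pos by (auto intro!: injI)
        have cP: "card P = nat (m - s + 1) + 1"
          using P sm card_image[OF inj_on_subset[OF inj, of "insert 0 {s..m}"]] by simp
        \<comment> \<open>Otherwise \<open>2 * s \<le> m\<close> forces \<open>s = 1\<close> and
          \<open>m = 2\<close>, which is the excluded set \<open>{x, 3 * x, 5 * x}\<close>.\<close>
        have "s + 2 \<le> m"
        proof (rule ccontr)
          assume "\<not> s + 2 \<le> m"
          then have "s = 1" "m = 2" using sm by linarith+
          then have "{s..m} = {1, 2}" by auto
          then show False using P exc by auto
        qed
        let ?I = "insert 0 {s..m}"
        let ?S = "{a + 2 * b + 1 | a b. a \<in> ?I \<and> b \<in> ?I \<and> a \<noteq> b \<and> m < a + 2 * b + 1 \<and> a + 2 * b + 1 \<le> 2 * m}"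
        have "?g ` ?S \<subseteq> window"
        proof
          fix u assume "u \<in> ?g ` ?S"
          then obtain a b where ab: "a \<in> ?I" "b \<in> ?I" "a \<noteq> b" "m < a + 2 * b + 1"
            "a + 2 * b + 1 \<le> 2 * m" and u: "u = ?g (a + 2 * b + 1)" by blast
          have u': "u = ?g a + 2 * ?g b" using u by (simp add: algebra_simps)
          have "?g m < ?g (a + 2 * b + 1)" using ab(4) x_pos by simp
          then have "M < u" using u M by simp
          moreover have "x + 2 * M = x * (2 * (2 * m + 1) + 1)" using M by (simp add: algebra_simps)
          moreover have "u < x * (2 * (2 * m + 1) + 1)"
            unfolding u using ab(5) x_pos by (intro mult_strict_left_mono) auto
          moreover have "?g a \<in> P" "?g b \<in> P" using ab P by blast+
          moreover have "?g a \<noteq> ?g b" using ab(3) x_pos by simp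
          ultimately show "u \<in> window" using windowI[of "?g a" "?g b"] u' by simp
        qed
        then have "card (?g ` ?S) \<le> card window" by (rule card_mono[OF finite_window])
        then have "card ?S \<le> card window" using card_image[OF inj_on_subset[OF inj, of ?S]] by simp
        then show ?thesis
          using arith_progression_window_card[OF sm \<open>s + 2 \<le> m\<close>] cP by (intro win) linarith
      qed
    qed
  qed
qed

end

section \<open>All sums \<open>a + 2 * \<Sum>J\<close>, reflection and deletion of the
  maximum\<close>

text \<open>The signed sums of \<open>P\<close> with coefficient 0 exactly at \<open>a\<close>,
  shifted by \<open>\<Sum>P\<close>; \<open>J\<close> is the set of elements with sign plus.\<close>

definition one_two_sums :: "int set \<Rightarrow> int set" where
  "one_two_sums P = {a + 2 * \<Sum>J | a J. a \<in> P \<and> J \<subseteq> P - {a}}"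

lemma one_two_sumsI: "a \<in> P \<Longrightarrow> J \<subseteq> P - {a} \<Longrightarrow> a + 2 * \<Sum>J \<in> one_two_sums P"
  unfolding one_two_sums_def by blast

lemma finite_one_two_sums:
  assumes "finite P" shows "finite (one_two_sums P)"
proof (rule finite_subset)
  show "one_two_sums P \<subseteq> (\<lambda>(a, J). a + 2 * \<Sum>J) ` (P \<times> Pow P)"
    by (auto simp: one_two_sums_def)
qed (use assms in simp)

lemma one_two_sums_mono: "P \<subseteq> Q \<Longrightarrow> one_two_sums P \<subseteq> one_two_sums Q"
  unfolding one_two_sums_def by blast

text \<open>Replacing \<open>J\<close> by its complement in \<open>P - {a}\<close> reverses all
  signs.\<close>

lemma one_two_sums_reflect:
  assumes "finite P" "u \<in> one_two_sums P"
  shows "2 * \<Sum>P - u \<in> one_two_sums P"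
proof -
  obtain a J where a: "a \<in> P" "J \<subseteq> P - {a}" and u: "u = a + 2 * \<Sum>J"
    using assms(2) by (auto simp: one_two_sums_def)
  have "\<Sum>(P - {a} - J) = \<Sum>P - a - \<Sum>J"
    using a assms(1) by (simp add: sum_diff sum_diff1)
  then have "2 * \<Sum>P - u = a + 2 * \<Sum>(P - {a} - J)" using u by simp
  then show ?thesis using one_two_sumsI[OF a(1), of "P - {a} - J"] by auto
qed

lemma one_two_sums_le:
  assumes "finite P" "\<And>a. a \<in> P \<Longrightarrow> x \<le> a" "0 < x" "u \<in> one_two_sums P"
  shows "u \<le> 2 * \<Sum>P - x"
proof -
  obtain a J where a: "a \<in> P" "J \<subseteq> P - {a}" and u: "u = a + 2 * \<Sum>J"
    using assms(4) by (auto simp: one_two_sums_def)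
  have "\<Sum>J \<le> \<Sum>(P - {a})" using assms a(2) by (intro sum_mono2) force+
  also have "\<dots> = \<Sum>P - a" using a assms(1) by (simp add: sum_diff1)
  finally show ?thesis using u assms(2)[OF a(1)] by linarith
qed

context pos_int_set
begin

lemma low_sums_subset: "low_sums \<subseteq> one_two_sums P"
proof
  fix u assume "u \<in> low_sums"
  then consider "u \<in> P" | a b where "a \<in> P" "b \<in> P" "a \<noteq> b" "u = a + 2 * b"
    by (auto simp: low_sums_def)
  then show "u \<in> one_two_sums P"
  proof cases
    case 1 then show ?thesis using one_two_sumsI[of u P "{}"] by simp
  next
    case 2 then show ?thesis using one_two_sumsI[of a P "{b}"] by simp
  qed
qed

text \<open>The reflection \<open>u \<mapsto> 2 \<Sum>P - u\<close> turns the low sums into sums exceeding all sums of \<open>P - {M}\<close>.\<close>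

lemma card_one_two_sums_step:
  assumes "E \<subseteq> one_two_sums P - one_two_sums (P - {M})" "\<And>u. u \<in> E \<Longrightarrow> u \<le> 2 * \<Sum>(P - {M}) - x"
  shows "card (one_two_sums (P - {M})) + card E + card low_sums \<le> card (one_two_sums P)"
proof -
  let ?r = "\<lambda>u. 2 * \<Sum>P - u"
  let ?A = "one_two_sums (P - {M})"
  have sum: "\<Sum>(P - {M}) = \<Sum>P - M" using fin M_in by (simp add: sum_diff1)
  have finA: "finite ?A" using finite_one_two_sums fin by simp
  have finU: "finite (one_two_sums P)" using finite_one_two_sums fin by simp
  then have finE: "finite E" using assms(1) finite_subset by blast
  have le: "u \<le> 2 * \<Sum>(P - {M}) - x" if "u \<in> ?A \<union> E" for u
    using that assms(2) one_two_sums_le[of "P - {M}" x u] fin bounds x_pos by auto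
  have "?r u > 2 * \<Sum>(P - {M}) - x" if "u \<in> low_sums" for u
    using that sum by (auto simp: low_sums_def)
  then have disj: "(?A \<union> E) \<inter> ?r ` low_sums = {}" using le by fastforce
  have sub: "?A \<union> E \<union> ?r ` low_sums \<subseteq> one_two_sums P"
    using assms(1) low_sums_subset one_two_sums_reflect[OF fin] one_two_sums_mono[of "P - {M}" P] by blast
  have "card (?A \<union> E \<union> ?r ` low_sums) = card (?A \<union> E) + card (?r ` low_sums)"
    by (rule card_Un_disjoint) (use finA finE finite_low_sums disj in auto)
  also have "card (?A \<union> E) = card ?A + card E"
    by (rule card_Un_disjoint) (use finA finE assms(1) in auto)
  also have "card (?r ` low_sums) = card low_sums" by (rule card_image) (simp add: inj_on_def)
  finally show ?thesis using card_mono[OF finU sub] by linarith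
qed

end

section \<open>The quadratic bound by induction, with the exceptional triple\<close>

lemma pos_int_set_Min_Max:
  assumes "finite P" "\<And>a. a \<in> P \<Longrightarrow> 0 < a" "2 \<le> card P"
  shows "pos_int_set P (Min P) (Max P)"
proof
  have ne: "P \<noteq> {}" using assms(3) by auto
  show "Min P \<in> P" "Max P \<in> P" using assms(1) ne by auto
  then show "0 < Min P" using assms(2) by blast
  have "Min P \<noteq> Max P"
  proof
    assume "Min P = Max P"
    then have "P \<subseteq> {Min P}" using assms(1) by (metis Max_ge Min_le antisym singletonI subsetI)
    then have "card P \<le> 1" using card_mono[of "{Min P}" P] by simp
    then show False using assms(3) by simp
  qed
  then show "Min P < Max P" using assms(1) ne by (metis Min_le Max_in order_le_less)
qed (use assms in auto)

lemma card_one_two_sums_pair: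
  fixes a b :: int
  assumes "0 < a" "a < b"
  shows "4 \<le> card (one_two_sums {a, b})"
proof -
  have "a \<in> one_two_sums {a, b}" using one_two_sumsI[of a "{a, b}" "{}"] by simp
  moreover have "b \<in> one_two_sums {a, b}" using one_two_sumsI[of b "{a, b}" "{}"] by simp
  moreover have "a + 2 * b \<in> one_two_sums {a, b}" using one_two_sumsI[of a "{a, b}" "{b}"] assms by simp
  moreover have "b + 2 * a \<in> one_two_sums {a, b}" using one_two_sumsI[of b "{a, b}" "{a}"] assms by simp
  ultimately have "card {a, b, a + 2 * b, b + 2 * a} \<le> card (one_two_sums {a, b})"
    by (intro card_mono finite_one_two_sums insert_subsetI empty_subsetI) auto
  then show ?thesis using assms by simp
qed

text \<open>In the exceptional triple the value \<open>9 * x\<close> is skipped, which leaves eight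
  sums where the quadratic bound would demand nine.\<close>

lemma one_two_sums_135:
  fixes x :: int
  assumes "0 < x"
  shows "one_two_sums {x, 3 * x, 5 * x} = (\<lambda>t. x * t) ` {1, 3, 5, 7, 11, 13, 15, 17}"
proof -
  have ne: "x \<noteq> 3 * x" "x \<noteq> 5 * x" "3 * x \<noteq> 5 * x" using assms by auto
  have d: "{x, 3 * x, 5 * x} - {x} = {3 * x, 5 * x}" "{x, 3 * x, 5 * x} - {3 * x} = {x, 5 * x}"
    "{x, 3 * x, 5 * x} - {5 * x} = {x, 3 * x}" using ne by auto
  have sub2: "J = {} \<or> J = {a} \<or> J = {b} \<or> J = {a, b}" if "J \<subseteq> {a, b}" for J and a b :: int
    using that by (cases "a \<in> J"; cases "b \<in> J") auto
  let ?P = "{x, 3 * x, 5 * x}" and ?R = "{x, 3 * x, 5 * x, 7 * x, 11 * x, 13 * x, 15 * x, 17 * x}"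
  have "one_two_sums ?P \<subseteq> ?R"
  proof
    fix u assume "u \<in> one_two_sums ?P"
    then obtain a J where a: "a \<in> ?P" and J: "J \<subseteq> ?P - {a}" and u: "u = a + 2 * \<Sum>J"
      by (auto simp: one_two_sums_def)
    consider "a = x" | "a = 3 * x" | "a = 5 * x" using a by blast
    then show "u \<in> ?R"
    proof cases
      case 1
      then show ?thesis using sub2[OF J[unfolded 1 d]] u ne by fastforce
    next
      case 2
      then show ?thesis using sub2[OF J[unfolded 2 d]] u ne by fastforce
    next
      case 3
      then show ?thesis using sub2[OF J[unfolded 3 d]] u ne by fastforce
    qed
  qed
  moreover have "?R \<subseteq> one_two_sums ?P"
    using one_two_sumsI[of x ?P "{}"] one_two_sumsI[of "3 * x" ?P "{}"] one_two_sumsI[of "5 * x" ?P "{}"]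
      one_two_sumsI[of x ?P "{3 * x}"] one_two_sumsI[of x ?P "{5 * x}"] one_two_sumsI[of x ?P "{3 * x, 5 * x}"]
      one_two_sumsI[of "3 * x" ?P "{5 * x}"] one_two_sumsI[of "3 * x" ?P "{x, 5 * x}"] ne
    by (intro insert_subsetI empty_subsetI) simp_all
  moreover have "(\<lambda>t. x * t) ` {1, 3, 5, 7, 11, 13, 15, 17} = ?R" by (simp add: mult.commute)
  ultimately show ?thesis by (metis subset_antisym)
qed

text \<open>The eight sums of the triple and the seven low sums give only 15. The missing one is
  either a new sum within the range of the triple or an eighth low sum.\<close>

lemma card_one_two_sums_135:
  fixes x y :: int
  assumes x: "0 < x" and y: "5 * x < y"
  shows "16 \<le> card (one_two_sums {x, 3 * x, 5 * x, y})"
proof -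
  let ?P = "{x, 3 * x, 5 * x, y}"
  interpret pos_int_set ?P x y
    by unfold_locales (use x y in auto)
  have P': "?P - {y} = {x, 3 * x, 5 * x}" using x y by auto
  have sum': "\<Sum>(?P - {y}) = 9 * x" unfolding P' using x by simp
  have U': "one_two_sums (?P - {y}) = (\<lambda>t. x * t) ` {1, 3, 5, 7, 11, 13, 15, 17}"
    using one_two_sums_135[OF x] P' by simp
  have "card ((\<lambda>t. x * t) ` {1, 3, 5, 7, 11, 13, 15, 17 :: int}) = card {1, 3, 5, 7, 11, 13, 15, 17 :: int}"
    by (rule card_image) (use x in \<open>simp add: inj_on_def\<close>)
  then have cU': "card (one_two_sums (?P - {y})) = 8" using U' by simp
  have cP: "card ?P = 4" using x y by simp
  have "y \<notin> {x, 3 * x, 5 * x}" using y x by simp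
  then have ne: "?P \<noteq> {x, 3 * x, 5 * x}" by blast
  have low: "7 \<le> card low_sums" using card_low_sums[OF _ ne] cP by simp
  \<comment> \<open>\<open>17 * x = 2 * (9 * x) - x\<close> is the largest sum of the
    triple.\<close>
  have extra: ?thesis if e: "e \<in> one_two_sums ?P" "e \<notin> one_two_sums (?P - {y})" "e \<le> 17 * x" for e
    using card_one_two_sums_step[of "{e}"] e sum' cU' low by simp
  show ?thesis
  proof (cases "y = 7 * x")
    case True
    \<comment> \<open>This is \<open>9 * x\<close>, the value that the triple skips.\<close>
    have "y + 2 * x \<in> one_two_sums ?P" using one_two_sumsI[of y ?P "{x}"] x y by simp
    moreover have "y + 2 * x = x * 9" using True by simp
    moreover have "x * 9 \<notin> one_two_sums (?P - {y})" unfolding U' using x by simp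
    ultimately show ?thesis using extra[of "x * 9"] x by simp
  next
    case n7: False
    show ?thesis
    proof (cases "y \<le> 17 * x \<and> y \<notin> one_two_sums (?P - {y})")
      case True
      moreover have "y \<in> one_two_sums ?P" using one_two_sumsI[of y ?P "{}"] by simp
      ultimately show ?thesis using extra[of y] by blast
    next
      case False
      \<comment> \<open>In each of these cases at most one coincidence occurs among the nine low
        sums listed below: \<open>y\<close> may equal \<open>11 * x\<close> or
        \<open>13 * x\<close>.\<close>
      then have y_cases: "y = 11 * x \<or> y = 13 * x \<or> 13 * x < y" using n7 x y unfolding U' by auto
      have inL: "a + 2 * b \<in> low_sums" if "a \<in> ?P" "b \<in> ?P" "a \<noteq> b" "a + 2 * b < x + 2 * y" for a b
        using that unfolding low_sums_def by blast
      have "x \<in> low_sums" "3 * x \<in> low_sums" "5 * x \<in> low_sums" "y \<in> low_sums"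
        using low_sums_superset by blast+
      moreover have "7 * x \<in> low_sums" "11 * x \<in> low_sums" "13 * x \<in> low_sums"
        using inL[of x "3 * x"] inL[of x "5 * x"] inL[of "3 * x" "5 * x"] x y_cases by auto
      moreover have "y + 6 * x \<in> low_sums" "y + 10 * x \<in> low_sums"
        using inL[of y "3 * x"] inL[of y "5 * x"] x y_cases by auto
      ultimately have "card {x, 3 * x, 5 * x, y, 7 * x, 11 * x, 13 * x, y + 6 * x, y + 10 * x} \<le> card low_sums"
        by (intro card_mono finite_low_sums insert_subsetI empty_subsetI)
      moreover have "8 \<le> card {x, 3 * x, 5 * x, y, 7 * x, 11 * x, 13 * x, y + 6 * x, y + 10 * x}"
        using y_cases x by (auto simp: card_insert_if)
      ultimately show ?thesis using card_one_two_sums_step[of "{}"] cU' by simp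
    qed
  qed
qed

text \<open>Deleting the maximum costs \<open>2 * n - 1 = n\<^sup>2 - (n - 1)\<^sup>2\<close> sums,
  where \<open>n = card P\<close>. The induction starts at size four, since deletion there may leave
  the exceptional triple, which needs its own count.\<close>

theorem card_one_two_sums:
  assumes "finite P" "\<And>a. a \<in> P \<Longrightarrow> 0 < a" "4 \<le> card P"
  shows "(card P)\<^sup>2 \<le> card (one_two_sums P)"
proof -
  have step: "card (one_two_sums (P - {Max P})) + (2 * card P - 1) \<le> card (one_two_sums P)"
    if "finite P" "\<And>a. a \<in> P \<Longrightarrow> 0 < a" "3 \<le> card P" "P \<noteq> {Min P, 3 * Min P, 5 * Min P}" for P
  proof -
    interpret pos_int_set P "Min P" "Max P" using pos_int_set_Min_Max that by simp
    show ?thesis using card_one_two_sums_step[of "{}"] card_low_sums that by simp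
  qed
  \<comment> \<open>Two elements give four sums, and the third adds
    \<open>2 * 3 - 1 = 5\<close>.\<close>
  have card3: "9 \<le> card (one_two_sums P)"
    if P: "finite P" "\<And>a. a \<in> P \<Longrightarrow> 0 < a" "card P = 3" "P \<noteq> {Min P, 3 * Min P, 5 * Min P}" for P
  proof -
    have "Max P \<in> P" using P by (intro Max_in) auto
    then have c: "card (P - {Max P}) = 2" using P by simp
    then obtain a b where ab: "P - {Max P} = {a, b}" "a < b"
      by (metis card_2_iff insert_commute linorder_less_linear)
    then have "4 \<le> card (one_two_sums (P - {Max P}))" using card_one_two_sums_pair[of a b] P(2)[of a] by auto
    then show ?thesis using step[OF P(1,2) _ P(4)] P(3) by simp
  qed
  show ?thesis using assms
  proof (induction "card P" arbitrary: P rule: less_induct)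
    case less
    let ?P' = "P - {Max P}"
    let ?x = "Min ?P'"
    have M: "Max P \<in> P" using less.prems by (intro Max_in) auto
    then have c: "card ?P' = card P - 1" using less.prems by simp
    have "P \<noteq> {Min P, 3 * Min P, 5 * Min P}"
    proof
      assume "P = {Min P, 3 * Min P, 5 * Min P}"
      then have "card P = card {Min P, 3 * Min P, 5 * Min P}" by (rule arg_cong)
      also have "\<dots> \<le> 3" by (simp add: card_insert_if)
      finally show False using less.prems by simp
    qed
    then have st: "card (one_two_sums ?P') + (2 * card P - 1) \<le> card (one_two_sums P)"
      using step[of P] less.prems by simp
    consider "card P = 4" "?P' = {?x, 3 * ?x, 5 * ?x}" | "card P = 4" "?P' \<noteq> {?x, 3 * ?x, 5 * ?x}"
      | "5 \<le> card P" using less.prems by linarith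
    then show ?case
    proof cases
      case 1
      then have in': "?x \<in> ?P'" "5 * ?x \<in> ?P'" by blast+
      have "0 < ?x" using less.prems(2) in' by blast
      moreover have "5 * ?x < Max P" using in'(2) less.prems(1) by (simp add: order_less_le)
      moreover have "P = {?x, 3 * ?x, 5 * ?x, Max P}" using 1(2) M by blast
      ultimately have "16 \<le> card (one_two_sums P)" using card_one_two_sums_135[of ?x "Max P"] by simp
      then show ?thesis using 1 by simp
    next
      case 2
      then have "9 \<le> card (one_two_sums ?P')" using card3[of ?P'] c less.prems by simp
      then show ?thesis using st 2 by simp
    next
      case 3
      obtain n where n: "card P = Suc n" using 3 by (cases "card P") auto
      have "(card ?P')\<^sup>2 \<le> card (one_two_sums ?P')"
        using less.hyps[of ?P'] less.prems 3 c by simp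
      then show ?thesis using st n c by (simp add: power2_eq_square)
    qed
  qed
qed

section \<open>The lower bound for signed sumsets\<close>

text \<open>\<open>X\<close> and \<open>Y\<close> are the places of the coefficients 1 and -1. In
  this form single elements can be exchanged.\<close>

lemma restricted_signed_sumset_eq:
  assumes "finite A"
  shows "restricted_signed_sumset h A =
    {\<Sum>X - \<Sum>Y | X Y. X \<subseteq> A \<and> Y \<subseteq> A \<and> X \<inter> Y = {} \<and> card X + card Y = h}" (is "_ = ?R")
proof
  show "restricted_signed_sumset h A \<subseteq> ?R"
  proof
    fix u assume "u \<in> restricted_signed_sumset h A"
    then obtain c :: "int \<Rightarrow> int" where c: "\<forall>a\<in>A. c a \<in> {-1, 0, 1}" "(\<Sum>a\<in>A. \<bar>c a\<bar>) = int h"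
      and u: "u = (\<Sum>a\<in>A. c a * a)"
      unfolding restricted_signed_sumset_def by blast
    define X where "X = {a \<in> A. c a = 1}"
    define Y where "Y = {a \<in> A. c a = -1}"
    have sum_X: "sum g X = (\<Sum>a\<in>A. if c a = 1 then g a else 0)"
      and sum_Y: "sum g Y = (\<Sum>a\<in>A. if c a = -1 then g a else 0)" for g :: "int \<Rightarrow> int"
      unfolding X_def Y_def using assms by (simp_all add: sum.inter_filter)
    have "u = \<Sum>X - \<Sum>Y"
      unfolding u sum_X sum_Y sum_subtractf[symmetric] by (rule sum.cong) (use c(1) in auto)
    moreover have "int (card X) + int (card Y) = int h"
    proof -
      have "int (card X) + int (card Y) = (\<Sum>a\<in>X. 1) + (\<Sum>a\<in>Y. 1)" by simp
      also have "\<dots> = (\<Sum>a\<in>A. \<bar>c a\<bar>)"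
        unfolding sum_X sum_Y sum.distrib[symmetric] by (rule sum.cong) (use c(1) in auto)
      finally show ?thesis using c(2) by simp
    qed
    moreover have "X \<subseteq> A" "Y \<subseteq> A" "X \<inter> Y = {}" by (auto simp: X_def Y_def)
    ultimately show "u \<in> ?R" by (auto simp flip: of_nat_add)
  qed
  show "?R \<subseteq> restricted_signed_sumset h A"
  proof
    fix u assume "u \<in> ?R"
    then obtain X Y where XY: "X \<subseteq> A" "Y \<subseteq> A" "X \<inter> Y = {}" "card X + card Y = h"
      and u: "u = \<Sum>X - \<Sum>Y" by blast
    define c :: "int \<Rightarrow> int" where "c a = (if a \<in> X then 1 else if a \<in> Y then -1 else 0)" for a
    have sum_X: "sum g X = (\<Sum>a\<in>A. if a \<in> X then g a else 0)"
      and sum_Y: "sum g Y = (\<Sum>a\<in>A. if a \<in> Y then g a else 0)" for g :: "int \<Rightarrow> int"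
      using assms XY sum.inter_restrict[of A g X] sum.inter_restrict[of A g Y]
      by (simp_all add: inf.absorb2)
    have "(\<Sum>a\<in>A. c a * a) = u"
      unfolding u sum_X sum_Y sum_subtractf[symmetric] by (rule sum.cong) (use XY in \<open>auto simp: c_def\<close>)
    moreover have "(\<Sum>a\<in>A. \<bar>c a\<bar>) = int h"
    proof -
      have "(\<Sum>a\<in>A. \<bar>c a\<bar>) = (\<Sum>a\<in>X. 1) + (\<Sum>a\<in>Y. 1)"
        unfolding sum_X sum_Y sum.distrib[symmetric] by (rule sum.cong) (use XY in \<open>auto simp: c_def\<close>)
      also have "\<dots> = int h" using XY(4) by simp
      finally show ?thesis .
    qed
    moreover have "\<forall>a\<in>A. c a \<in> {-1, 0, 1}" by (simp add: c_def)
    ultimately show "u \<in> restricted_signed_sumset h A"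
      unfolding restricted_signed_sumset_def by blast
  qed
qed

lemma restricted_signed_sumsetI:
  assumes "finite A" "X \<subseteq> A" "Y \<subseteq> A" "X \<inter> Y = {}" "card X + card Y = h"
  shows "\<Sum>X - \<Sum>Y \<in> restricted_signed_sumset h A"
  using assms restricted_signed_sumset_eq by blast

lemma finite_restricted_signed_sumset:
  assumes "finite A" shows "finite (restricted_signed_sumset h A)"
proof (rule finite_subset)
  show "restricted_signed_sumset h A \<subseteq> (\<lambda>(X, Y). \<Sum>X - \<Sum>Y) ` (Pow A \<times> Pow A)"
    unfolding restricted_signed_sumset_eq[OF assms] by auto
qed (use assms in simp)

lemma restricted_signed_sumset_abs_le:
  assumes A: "finite A" "\<And>a. a \<in> A \<Longrightarrow> 0 < a"
    and B: "\<And>S. S \<subseteq> A \<Longrightarrow> card S = h \<Longrightarrow> \<Sum>S \<le> B"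
    and u: "u \<in> restricted_signed_sumset h A"
  shows "\<bar>u\<bar> \<le> B"
proof -
  obtain X Y where XY: "X \<subseteq> A" "Y \<subseteq> A" "X \<inter> Y = {}" "card X + card Y = h" "u = \<Sum>X - \<Sum>Y"
    using u unfolding restricted_signed_sumset_eq[OF A(1)] by blast
  have fin: "finite X" "finite Y" using XY A(1) finite_subset by blast+
  have "0 \<le> \<Sum>Z" if "Z \<subseteq> A" for Z
    by (rule sum_nonneg) (use that A(2) in \<open>auto intro: less_imp_le\<close>)
  then have "0 \<le> \<Sum>X" "0 \<le> \<Sum>Y" using XY by blast+
  moreover have "\<Sum>X + \<Sum>Y \<le> B"
    using B[of "X \<union> Y"] XY fin by (simp add: sum.union_disjoint card_Un_disjoint)
  ultimately show ?thesis using XY(5) by linarith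
qed

text \<open>If \<open>S\<close> has the largest sum among the \<open>h\<close>-subsets without the
  maximum, the old signed sums lie between \<open>- \<Sum>S\<close> and \<open>\<Sum>S\<close>. The
  \<open>h\<close> exchanged sums in \<open>E\<close> and their negatives fall outside this
  range.\<close>

lemma card_restricted_signed_sumset_step:
  assumes A: "finite A" "\<And>a. a \<in> A \<Longrightarrow> 0 < a" and h: "h < card A"
  shows "card (restricted_signed_sumset h (A - {Max A})) + 2 * h \<le> card (restricted_signed_sumset h A)"
proof -
  let ?M = "Max A" let ?B = "A - {Max A}"
  let ?R = "restricted_signed_sumset h"
  have M: "?M \<in> A" using A(1) h by (intro Max_in) auto
  have finB: "finite ?B" using A(1) by simp
  have less: "a < ?M" if "a \<in> ?B" for a using that A(1) by (simp add: order_less_le)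
  have "h \<le> card ?B" using M A(1) h by simp
  then obtain S0 where S0: "S0 \<subseteq> ?B" "card S0 = h" by (meson obtain_subset_with_card_n)
  let ?F = "{S. S \<subseteq> ?B \<and> card S = h}"
  have F: "finite ?F" "?F \<noteq> {}" using finB S0 by auto
  \<comment> \<open>Minimizing the negated sum selects an \<open>h\<close>-subset of largest
    sum.\<close>
  define S where "S = arg_min_on (\<lambda>S. - \<Sum>S) ?F"
  have "S \<in> ?F" unfolding S_def by (rule arg_min_if_finite(1)[OF F])
  then have S: "S \<subseteq> ?B" "card S = h" by auto
  have S_max: "\<Sum>T \<le> \<Sum>S" if "T \<subseteq> ?B" "card T = h" for T
    using arg_min_least[OF F, of T "\<lambda>S. - \<Sum>S"] that by (simp add: S_def)
  have finS: "finite S" using S finB finite_subset by blast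
  define E where "E = (\<lambda>s. \<Sum>S - s + ?M) ` S"
  have cE: "card E = h" unfolding E_def using S(2) by (subst card_image) (auto simp: inj_on_def)
  have finE: "finite E" unfolding E_def using finS by simp
  have "s < ?M" if "s \<in> S" for s using less S(1) that by blast
  then have E_gt: "\<Sum>S < e" if "e \<in> E" for e using that by (auto simp: E_def)
  have abs_le: "\<bar>u\<bar> \<le> \<Sum>S" if "u \<in> ?R ?B" for u
    by (rule restricted_signed_sumset_abs_le[OF finB _ S_max that]) (use A(2) in auto)
  have "?R ?B \<subseteq> ?R A"
    unfolding restricted_signed_sumset_eq[OF A(1)] restricted_signed_sumset_eq[OF finB] by blast
  moreover have "e \<in> ?R A \<and> - e \<in> ?R A" if "e \<in> E" for e
  proof -
    obtain s where s: "s \<in> S" "e = \<Sum>S - s + ?M" using \<open>e \<in> E\<close> by (auto simp: E_def)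
    let ?T = "insert ?M (S - {s})"
    have MS: "?M \<notin> S" using S by auto
    have T: "?T \<subseteq> A" "card ?T = h" "\<Sum>?T = e"
      using s S M MS finS card_Suc_Diff1[OF finS s(1)] by (auto simp: sum_diff1)
    show ?thesis
      using restricted_signed_sumsetI[OF A(1) T(1), of "{}" h] restricted_signed_sumsetI[OF A(1) _ T(1), of "{}" h] T
      by simp
  qed
  ultimately have "?R ?B \<union> (E \<union> uminus ` E) \<subseteq> ?R A" by blast
  then have "card (?R ?B \<union> (E \<union> uminus ` E)) \<le> card (?R A)"
    by (rule card_mono[OF finite_restricted_signed_sumset[OF A(1)]])
  moreover have "card (?R ?B \<union> (E \<union> uminus ` E)) = card (?R ?B) + card (E \<union> uminus ` E)"
  proof (rule card_Un_disjoint)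
    show "?R ?B \<inter> (E \<union> uminus ` E) = {}"
      using abs_le E_gt by fastforce
  qed (use finite_restricted_signed_sumset[OF finB] finE in auto)
  moreover have "card (E \<union> uminus ` E) = card E + card (uminus ` E)"
  proof (rule card_Un_disjoint)
    have "0 \<le> \<Sum>S" by (rule sum_nonneg) (use S A(2) in \<open>auto intro: less_imp_le\<close>)
    then have "0 < e" if "e \<in> E" for e using E_gt[OF that] by linarith
    then have "E \<subseteq> {0<..}" "uminus ` E \<subseteq> {..<0}" by auto
    then show "E \<inter> uminus ` E = {}" by fastforce
  qed (use finE in auto)
  moreover have "card (uminus ` E) = card E" by (rule card_image) simp
  ultimately show ?thesis using cE by simp
qed

lemma card_restricted_signed_sumset_all_but_one:
  assumes A: "finite A" "\<And>a. a \<in> A \<Longrightarrow> 0 < a" and h: "card A = h + 1" "3 \<le> h"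
  shows "(h + 1)\<^sup>2 \<le> card (restricted_signed_sumset h A)"
proof -
  have "(\<lambda>u. u - \<Sum>A) ` one_two_sums A \<subseteq> restricted_signed_sumset h A"
  proof
    fix v assume "v \<in> (\<lambda>u. u - \<Sum>A) ` one_two_sums A"
    then obtain a J where a: "a \<in> A" "J \<subseteq> A - {a}" and v: "v = a + 2 * \<Sum>J - \<Sum>A"
      by (auto simp: one_two_sums_def)
    \<comment> \<open>\<open>?Y\<close> receives the minus signs, and only \<open>a\<close> is left
      out, so exactly \<open>h\<close> of the \<open>h + 1\<close> elements are used.\<close>
    let ?Y = "A - {a} - J"
    have finJ: "finite J" using a(2) A(1) finite_subset by blast
    have "\<Sum>?Y = \<Sum>A - a - \<Sum>J" using a A(1) by (simp add: sum_diff sum_diff1)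
    then have "v = \<Sum>J - \<Sum>?Y" using v by simp
    moreover have "card J + card ?Y = h"
      using a A(1) h finJ card_Diff_subset[OF finJ a(2)] card_mono[OF _ a(2)] by simp
    ultimately show "v \<in> restricted_signed_sumset h A"
      using restricted_signed_sumsetI[OF A(1), of J ?Y h] a(2) by auto
  qed
  then have "card ((\<lambda>u. u - \<Sum>A) ` one_two_sums A) \<le> card (restricted_signed_sumset h A)"
    by (rule card_mono[OF finite_restricted_signed_sumset[OF A(1)]])
  moreover have "card ((\<lambda>u. u - \<Sum>A) ` one_two_sums A) = card (one_two_sums A)"
    by (rule card_image) (simp add: inj_on_def)
  ultimately show ?thesis using card_one_two_sums[OF A] h by simp
qed

text \<open>At \<open>k = h + 1\<close> the bound equals \<open>(h + 1)\<^sup>2\<close>, and each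
  further element raises it by \<open>2 * h\<close>.\<close>

theorem card_restricted_signed_sumset_ge:
  assumes "finite A" "\<And>a. a \<in> A \<Longrightarrow> 0 < a" "card A = k" "3 \<le> h" "h + 1 \<le> k"
  shows "2 * int h * int k - (int h)\<^sup>2 + 1 \<le> int (card (restricted_signed_sumset h A))"
  using assms(5,1-3)
proof (induction k arbitrary: A rule: dec_induct)
  case base
  have "int ((h + 1)\<^sup>2) \<le> int (card (restricted_signed_sumset h A))"
    using card_restricted_signed_sumset_all_but_one[of A h] base assms(4) by (simp only: of_nat_le_iff)
  then show ?case by (simp add: power2_eq_square algebra_simps)
next
  case (step k)
  have "Max A \<in> A" using step by (intro Max_in) auto
  then have "card (A - {Max A}) = k" using step by simp
  then have "2 * int h * int k - (int h)\<^sup>2 + 1 \<le> int (card (restricted_signed_sumset h (A - {Max A})))"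
    using step.IH[of "A - {Max A}"] step.prems by simp
  moreover have "card (restricted_signed_sumset h (A - {Max A})) + 2 * h \<le> card (restricted_signed_sumset h A)"
    using card_restricted_signed_sumset_step[of A h] step by simp
  ultimately show ?case by (simp add: algebra_simps)
qed

section \<open>Sharpness: the first \<open>k\<close> odd numbers\<close>

definition first_odds :: "nat \<Rightarrow> int set" where
  "first_odds k = (\<lambda>i. 2 * int i + 1) ` {..<k}"

lemma finite_first_odds: "finite (first_odds k)"
  by (simp add: first_odds_def)

lemma card_first_odds: "card (first_odds k) = k"
  unfolding first_odds_def by (subst card_image) (auto simp: inj_on_def)

text \<open>With \<open>j = card S\<close>, the bound \<open>k\<^sup>2 - (k - j)\<^sup>2\<close> is
  the sum of the \<open>j\<close> largest of the first \<open>k\<close> odd numbers.\<close>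

lemma first_odds_sum_le:
  assumes "S \<subseteq> first_odds k"
  shows "\<Sum>S \<le> 2 * int (card S) * int k - (int (card S))\<^sup>2"
  using assms
proof (induction k arbitrary: S)
  case 0
  then show ?case by (simp add: first_odds_def)
next
  case (Suc k)
  have fin: "finite S" using Suc.prems finite_first_odds finite_subset by blast
  have eq: "first_odds (Suc k) = insert (2 * int k + 1) (first_odds k)"
    by (simp add: first_odds_def lessThan_Suc)
  show ?case
  proof (cases "2 * int k + 1 \<in> S")
    case True
    let ?T = "S - {2 * int k + 1}"
    have "\<Sum>?T \<le> 2 * int (card ?T) * int k - (int (card ?T))\<^sup>2"
      using Suc.IH[of ?T] Suc.prems eq by auto
    moreover have "card S = Suc (card ?T)" "\<Sum>S = \<Sum>?T + (2 * int k + 1)"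
      using True fin card_Suc_Diff1[OF fin True] by (auto simp: sum_diff1)
    ultimately show ?thesis by (simp add: power2_eq_square algebra_simps)
  next
    case False
    then have "\<Sum>S \<le> 2 * int (card S) * int k - (int (card S))\<^sup>2"
      using Suc.IH[of S] Suc.prems eq by auto
    then show ?thesis by (simp add: algebra_simps)
  qed
qed

text \<open>All signed sums lie between \<open>- ?N\<close> and \<open>?N\<close> and share the
  parity of \<open>h\<close>, hence of \<open>?N\<close>. This leaves \<open>?N + 1\<close>
  values.\<close>

lemma card_restricted_signed_sumset_first_odds_le:
  assumes "h \<le> k"
  shows "int (card (restricted_signed_sumset h (first_odds k))) \<le> 2 * int h * int k - (int h)\<^sup>2 + 1"
proof -
  let ?N = "2 * int h * int k - (int h)\<^sup>2"
  let ?R = "restricted_signed_sumset h (first_odds k)"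
  have "?N = int h * (2 * int k - int h)" by (simp add: power2_eq_square algebra_simps)
  then have N: "0 \<le> ?N" using assms by simp
  have "?R \<subseteq> (\<lambda>i. 2 * i - ?N) ` {0..?N}"
  proof
    fix u assume u: "u \<in> ?R"
    have odds: "odd a" if "a \<in> first_odds k" for a using that by (auto simp: first_odds_def)
    have "\<bar>u\<bar> \<le> ?N"
    proof (rule restricted_signed_sumset_abs_le[OF finite_first_odds _ _ u])
      show "0 < a" if "a \<in> first_odds k" for a using that by (auto simp: first_odds_def)
      show "\<Sum>S \<le> ?N" if "S \<subseteq> first_odds k" "card S = h" for S
        using first_odds_sum_le[OF that(1)] that(2) by simp
    qed
    moreover have "even (u + ?N)"
    proof -
      obtain X Y where XY: "X \<subseteq> first_odds k" "Y \<subseteq> first_odds k" "card X + card Y = h" "u = \<Sum>X - \<Sum>Y"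
        using u unfolding restricted_signed_sumset_eq[OF finite_first_odds] by blast
      have par: "even (\<Sum>Z) = even (card Z)" if "Z \<subseteq> first_odds k" for Z
      proof -
        have "finite Z" using that finite_first_odds finite_subset by blast
        moreover have "{a \<in> Z. odd a} = Z" using that odds by blast
        ultimately show ?thesis using even_sum_iff[of Z "\<lambda>a. a"] by simp
      qed
      have "even u = even h" using XY par[OF XY(1)] par[OF XY(2)] by auto
      then show ?thesis by auto
    qed
    ultimately obtain i where "u + ?N = 2 * i" "\<bar>u\<bar> \<le> ?N" by (metis evenE)
    then show "u \<in> (\<lambda>i. 2 * i - ?N) ` {0..?N}" by (intro image_eqI[of _ _ i]) auto
  qed
  then have "card ?R \<le> card ((\<lambda>i. 2 * i - ?N) ` {0..?N})" by (rule card_mono[rotated]) simp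
  also have "\<dots> \<le> card {0..?N}" by (rule card_image_le) simp
  finally show ?thesis using N by simp
qed

theorem theorem1:
  fixes h k :: nat
  assumes "3 \<le> h" and "h \<le> k - 1"
  shows "(\<forall>A :: int set. finite A \<and> card A = k \<and> (\<forall>a\<in>A. 0 < a) \<longrightarrow>
            int (card (restricted_signed_sumset h A)) \<ge> 2 * int h * int k - (int h)\<^sup>2 + 1) \<and>
         (\<exists>A :: int set. finite A \<and> card A = k \<and> (\<forall>a\<in>A. 0 < a) \<and>
            int (card (restricted_signed_sumset h A)) = 2 * int h * int k - (int h)\<^sup>2 + 1)"
proof -
  \<comment> \<open>As \<open>h\<close> is positive, the natural subtraction \<open>k - 1\<close> is
    not truncated.\<close>
  have hk: "h + 1 \<le> k" using assms by linarith
  have lower: "2 * int h * int k - (int h)\<^sup>2 + 1 \<le> int (card (restricted_signed_sumset h A))"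
    if "finite A" "card A = k" "\<forall>a\<in>A. 0 < a" for A
    using card_restricted_signed_sumset_ge[of A k h] that assms(1) hk by blast
  have pos: "\<forall>a\<in>first_odds k. 0 < a" by (auto simp: first_odds_def)
  have "int (card (restricted_signed_sumset h (first_odds k))) = 2 * int h * int k - (int h)\<^sup>2 + 1"
    using lower[OF finite_first_odds card_first_odds pos]
      card_restricted_signed_sumset_first_odds_le[of h k] hk by linarith
  then show ?thesis using lower finite_first_odds card_first_odds pos by blast
qed

end
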